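(* Let $G$ be any finitely generated group and let $X\subset A^G$ be a subshift with topological strong spatial mixing. Then $X$ is a subshift of finite type.
   Context: $G$ carries a finite generating set and the left-invariant word metric $d$; $d(U,V)=\min\{d(u,v):u\in U,v\in V\}$. $A$ is a finite alphabet, $G$ acts on $A^G$ by $(gx)_h=x_{g^{-1}h}$; a subshift is a closed $G$-invariant $X\subset A^G$; it is of finite type if it is the set of all $x\in A^G$ in which no pattern (element of $A^D$, $D\subset G$ finite, possibly empty) from some fixed finite set occurs at any translate. For a pattern $P\in A^D$, $P\sqsubset X$ means $P$ is the restriction to $D$ of some point of $X$. $X$ has topological strong spatial mixing if for some $n\in\mathbb N$ (the gap): for all pairwise disjoint finite $U,V,S\subset G$ with $d(U,V)\ge n$ and all $u\in A^U,v\in A^V,s\in A^S$, if $u\sqcup s\sqsubset X$ and $s\sqcup v\sqsubset X$ then $u\sqcup s\sqcup v\sqsubset X$ ($\sqcup$ is union of patterns). *)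

theory Defs
  imports
    "HOL-Algebra.Generated_Groups"
    "HOL-Analysis.Function_Topology"
    "HOL-Analysis.Finite_Product_Measure"
    "HOL-Library.Extended_Nat"
begin

definition word_length :: "('g, 'm) monoid_scheme \<Rightarrow> 'g set \<Rightarrow> 'g \<Rightarrow> nat" where
  "word_length G K g =
     (LEAST n. \<exists>w. length w = n \<and> set w \<subseteq> K \<union> (\<lambda>k. inv\<^bsub>G\<^esub> k) ` K \<and>
                   foldr (\<lambda>a b. a \<otimes>\<^bsub>G\<^esub> b) w \<one>\<^bsub>G\<^esub> = g)"

definition word_dist :: "('g, 'm) monoid_scheme \<Rightarrow> 'g set \<Rightarrow> 'g \<Rightarrow> 'g \<Rightarrow> nat" where
  "word_dist G K g h = word_length G K (inv\<^bsub>G\<^esub> g \<otimes>\<^bsub>G\<^esub> h)"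

text \<open>The infimum is a minimum for nonempty sets; the distance to the empty set is infinite.\<close>

definition set_word_dist :: "('g, 'm) monoid_scheme \<Rightarrow> 'g set \<Rightarrow> 'g set \<Rightarrow> 'g set \<Rightarrow> enat" where
  "set_word_dist G K U V = (INF u\<in>U. INF v\<in>V. enat (word_dist G K u v))"

text \<open>For a finite alphabet \<open>A\<close>, the set \<open>A\<^sup>G\<close> consists of the extensional functions from
  \<open>carrier G\<close> to \<open>A\<close>, and carries the product of the discrete topologies.\<close>

definition config_topology :: "('g, 'm) monoid_scheme \<Rightarrow> 'a set \<Rightarrow> ('g \<Rightarrow> 'a) topology" where
  "config_topology G A = product_topology (\<lambda>_. discrete_topology A) (carrier G)"

definition shift :: "('g, 'm) monoid_scheme \<Rightarrow> 'g \<Rightarrow> ('g \<Rightarrow> 'a) \<Rightarrow> ('g \<Rightarrow> 'a)" where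
  "shift G g x = (\<lambda>h\<in>carrier G. x (inv\<^bsub>G\<^esub> g \<otimes>\<^bsub>G\<^esub> h))"

definition subshift :: "('g, 'm) monoid_scheme \<Rightarrow> 'a set \<Rightarrow> ('g \<Rightarrow> 'a) set \<Rightarrow> bool" where
  "subshift G A X \<longleftrightarrow>
     closedin (config_topology G A) X \<and> (\<forall>g\<in>carrier G. \<forall>x\<in>X. shift G g x \<in> X)"

text \<open>A pattern is a pair of a finite support and an extensional function on it.  The support has
  to be recorded separately, since \<open>undefined\<close> may be an element of the alphabet.\<close>

definition patterns :: "('g, 'm) monoid_scheme \<Rightarrow> 'a set \<Rightarrow> ('g set \<times> ('g \<Rightarrow> 'a)) set" where
  "patterns G A = {(D, p). finite D \<and> D \<subseteq> carrier G \<and> p \<in> D \<rightarrow>\<^sub>E A}"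

text \<open>The translate by \<open>g\<close> of \<open>p \<in> A\<^sup>D\<close> has support \<open>gD\<close> and value \<open>p h\<close> at \<open>gh\<close>.\<close>

definition occurs_at ::
  "('g, 'm) monoid_scheme \<Rightarrow> 'g set \<times> ('g \<Rightarrow> 'a) \<Rightarrow> 'g \<Rightarrow> ('g \<Rightarrow> 'a) \<Rightarrow> bool" where
  "occurs_at G P g x \<longleftrightarrow> (\<forall>h\<in>fst P. x (g \<otimes>\<^bsub>G\<^esub> h) = snd P h)"

definition subshift_of_finite_type ::
  "('g, 'm) monoid_scheme \<Rightarrow> 'a set \<Rightarrow> ('g \<Rightarrow> 'a) set \<Rightarrow> bool" where
  "subshift_of_finite_type G A X \<longleftrightarrow>
     subshift G A X \<and>
     (\<exists>F. finite F \<and> F \<subseteq> patterns G A \<and>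
          X = {x \<in> carrier G \<rightarrow>\<^sub>E A. \<forall>P\<in>F. \<forall>g\<in>carrier G. \<not> occurs_at G P g x})"

definition appears_in :: "'g set \<Rightarrow> ('g \<Rightarrow> 'a) \<Rightarrow> ('g \<Rightarrow> 'a) set \<Rightarrow> bool" where
  "appears_in D p X \<longleftrightarrow> (\<exists>x\<in>X. restrict x D = p)"

text \<open>The union \<open>p \<squnion> q\<close> of patterns with disjoint supports \<open>D\<close>, \<open>E\<close> is \<open>merge D E (p, q)\<close>.\<close>

definition TSSM_with_gap ::
  "('g, 'm) monoid_scheme \<Rightarrow> 'g set \<Rightarrow> 'a set \<Rightarrow> nat \<Rightarrow> ('g \<Rightarrow> 'a) set \<Rightarrow> bool" where
  "TSSM_with_gap G K A n X \<longleftrightarrow>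
     (\<forall>U V S u v s.
        finite U \<and> finite V \<and> finite S \<and>
        U \<subseteq> carrier G \<and> V \<subseteq> carrier G \<and> S \<subseteq> carrier G \<and>
        U \<inter> V = {} \<and> U \<inter> S = {} \<and> S \<inter> V = {} \<and>
        set_word_dist G K U V \<ge> enat n \<and>
        u \<in> U \<rightarrow>\<^sub>E A \<and> v \<in> V \<rightarrow>\<^sub>E A \<and> s \<in> S \<rightarrow>\<^sub>E A \<and>
        appears_in (U \<union> S) (merge U S (u, s)) X \<and>
        appears_in (S \<union> V) (merge S V (s, v)) X
        \<longrightarrow> appears_in (U \<union> S \<union> V) (merge (U \<union> S) V (merge U S (u, s), v)) X)"

definition TSSM ::
  "('g, 'm) monoid_scheme \<Rightarrow> 'g set \<Rightarrow> 'a set \<Rightarrow> ('g \<Rightarrow> 'a) set \<Rightarrow> bool" where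
  "TSSM G K A X \<longleftrightarrow> (\<exists>n. TSSM_with_gap G K A n X)"

end

theory Submission imports Defs
begin

text \<open>
  Let \<open>n\<close> be a gap for \<open>X\<close>, and let \<open>B\<close> consist of the identity and the elements of word length
  less than \<open>n\<close>; it is finite because \<open>K\<close> is finite and generates \<open>G\<close>.  Then \<open>X\<close> is defined by forbidding all patterns
  with support contained in \<open>B\<close> that do not appear in \<open>X\<close>; there are finitely many
  of them because \<open>A\<close> is finite too.

  Shift invariance of \<open>X\<close> shows that no point of \<open>X\<close> contains such a pattern.  Conversely, let
  \<open>y\<close> avoid all of them.  Since \<open>X\<close> is closed, it suffices that every finite restriction \<open>y|W\<close>
  appears in \<open>X\<close> (\<open>subshift_contains_if_restrictions_appear\<close>), and this is shown by induction on
  \<open>|W|\<close> (\<open>restrictions_appear\<close>).  Fix \<open>w \<in> W\<close>.  If some other \<open>w' \<in> W\<close> has distance at least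
  \<open>n\<close> from \<open>w\<close>, then \<open>y\<close> restricted to \<open>W - {w'}\<close> and to \<open>W - {w}\<close> appears in \<open>X\<close> by induction,
  and mixing with \<open>U = {w}\<close>, \<open>V = {w'}\<close> and \<open>S = W - {w, w'}\<close> glues the two restrictions.
  If there is no such \<open>w'\<close>, then \<open>W \<subseteq> wB\<close>, and \<open>y|W\<close> is a translate of a pattern with support in
  \<open>B\<close>, which is not forbidden and hence appears in \<open>X\<close>.
\<close>

context group
begin

lemma foldr_mult_closed:
  assumes "set w \<subseteq> carrier G"
  shows "foldr (\<lambda>a b. a \<otimes> b) w \<one> \<in> carrier G"
  using assms by (induction w) auto

lemma foldr_mult_append:
  assumes "set v \<subseteq> carrier G" "set w \<subseteq> carrier G"
  shows "foldr (\<lambda>a b. a \<otimes> b) (v @ w) \<one> =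
         foldr (\<lambda>a b. a \<otimes> b) v \<one> \<otimes> foldr (\<lambda>a b. a \<otimes> b) w \<one>"
  using assms
proof (induction v)
  case Nil
  then show ?case using foldr_mult_closed[of w] by simp
next
  case (Cons a v)
  then show ?case using foldr_mult_closed[of w] foldr_mult_closed[of v]
    by (simp add: m_assoc)
qed

lemma generate_imp_word:
  assumes "K \<subseteq> carrier G" "g \<in> generate G K"
  shows "\<exists>w. set w \<subseteq> K \<union> (\<lambda>k. inv k) ` K \<and> foldr (\<lambda>a b. a \<otimes> b) w \<one> = g"
  using assms(2)
proof (induction rule: generate.induct)
  case one
  show ?case by (intro exI[of _ "[]"]) simp
next
  case (incl h)
  then show ?case using assms(1) by (intro exI[of _ "[h]"]) auto
next
  case (inv h)
  then show ?case using assms(1) by (intro exI[of _ "[inv h]"]) auto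
next
  case (eng g h)
  then obtain v w where
    v: "set v \<subseteq> K \<union> (\<lambda>k. inv k) ` K" "foldr (\<lambda>a b. a \<otimes> b) v \<one> = g" and
    w: "set w \<subseteq> K \<union> (\<lambda>k. inv k) ` K" "foldr (\<lambda>a b. a \<otimes> b) w \<one> = h"
    by blast
  have "K \<union> (\<lambda>k. inv k) ` K \<subseteq> carrier G"
    using assms(1) by auto
  then have "foldr (\<lambda>a b. a \<otimes> b) (v @ w) \<one> = g \<otimes> h"
    using foldr_mult_append[of v w] v w by auto
  then show ?case using v w by (intro exI[of _ "v @ w"]) auto
qed

text \<open>That \<open>K\<close> generates is essential here: \<open>word_length\<close> is an unspecified number on an element that is
  not a word in \<open>K\<close>.\<close>

lemma finite_word_ball:
  assumes "finite K" "K \<subseteq> carrier G" "generate G K = carrier G"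
  shows "finite {g \<in> carrier G. word_length G K g < n}"
proof -
  let ?L = "K \<union> (\<lambda>k. inv k) ` K"
  let ?words = "{w. set w \<subseteq> ?L \<and> length w \<le> n}"
  have "{g \<in> carrier G. word_length G K g < n} \<subseteq> (\<lambda>w. foldr (\<lambda>a b. a \<otimes> b) w \<one>) ` ?words"
  proof
    fix g assume g: "g \<in> {g \<in> carrier G. word_length G K g < n}"
    then have "\<exists>m w. length w = m \<and> set w \<subseteq> ?L \<and> foldr (\<lambda>a b. a \<otimes> b) w \<one> = g"
      using generate_imp_word[of K g] assms(2,3) by auto
    then have "\<exists>w. length w = word_length G K g \<and> set w \<subseteq> ?L \<and> foldr (\<lambda>a b. a \<otimes> b) w \<one> = g"
      unfolding word_length_def by (rule LeastI_ex)
    then show "g \<in> (\<lambda>w. foldr (\<lambda>a b. a \<otimes> b) w \<one>) ` ?words"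
      using g by force
  qed
  moreover have "finite ?words"
    using assms(1) by (intro finite_lists_length_le) simp
  ultimately show ?thesis
    by (rule finite_subset[OF _ finite_imageI])
qed

end

lemma subshift_subset:
  assumes "subshift G A X"
  shows "X \<subseteq> carrier G \<rightarrow>\<^sub>E A"
  using assms closedin_subset[of "config_topology G A" X]
  by (simp add: subshift_def config_topology_def)

text \<open>A basic neighbourhood of \<open>y\<close> in the product topology constrains only finitely many
  coordinates.\<close>

lemma subshift_contains_if_restrictions_appear:
  assumes "subshift G A X" and y: "y \<in> carrier G \<rightarrow>\<^sub>E A"
    and appear: "\<And>W. finite W \<Longrightarrow> W \<subseteq> carrier G \<Longrightarrow> appears_in W (restrict y W) X"
  shows "y \<in> X"
proof (rule ccontr)
  assume "y \<notin> X"
  let ?C = "carrier G \<rightarrow>\<^sub>E A"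
  have "openin (product_topology (\<lambda>_. discrete_topology A) (carrier G)) (?C - X)"
    using assms(1) by (simp add: subshift_def config_topology_def closedin_def)
  then have "\<forall>z\<in>?C - X. \<exists>N. finite {i \<in> carrier G. N i \<noteq> A} \<and>
      (\<forall>i\<in>carrier G. openin (discrete_topology A) (N i)) \<and>
      z \<in> Pi\<^sub>E (carrier G) N \<and> Pi\<^sub>E (carrier G) N \<subseteq> ?C - X"
    by (simp only: openin_product_topology_alt topspace_discrete_topology)
  then have "\<exists>N. finite {i \<in> carrier G. N i \<noteq> A} \<and>
      (\<forall>i\<in>carrier G. openin (discrete_topology A) (N i)) \<and>
      y \<in> Pi\<^sub>E (carrier G) N \<and> Pi\<^sub>E (carrier G) N \<subseteq> ?C - X"
    by (rule bspec) (use y \<open>y \<notin> X\<close> in simp)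
  then obtain N where
    fin: "finite {i \<in> carrier G. N i \<noteq> A}" and
    yN: "y \<in> Pi\<^sub>E (carrier G) N" and N: "Pi\<^sub>E (carrier G) N \<subseteq> ?C - X"
    by blast
  obtain x where x: "x \<in> X"
    and eq: "restrict x {i \<in> carrier G. N i \<noteq> A} = restrict y {i \<in> carrier G. N i \<noteq> A}"
    using appear[OF fin] by (auto simp: appears_in_def)
  have xC: "x \<in> ?C"
    using x subshift_subset[OF assms(1)] by auto
  have "x i \<in> N i" if "i \<in> carrier G" for i
  proof (cases "N i = A")
    case True
    then show ?thesis using xC that by auto
  next
    case False
    then have "x i = y i"
      using fun_cong[OF eq, of i] that by simp
    then show ?thesis using yN that by auto
  qed
  then have "x \<in> Pi\<^sub>E (carrier G) N"
    using xC by (auto simp: PiE_iff)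
  then show False using N x by auto
qed

lemma appears_in_translate:
  assumes "group G" "subshift G A X" and g: "g \<in> carrier G" and D: "D \<subseteq> carrier G"
    and "appears_in D (\<lambda>h\<in>D. y (g \<otimes>\<^bsub>G\<^esub> h)) X"
  shows "appears_in ((\<lambda>h. g \<otimes>\<^bsub>G\<^esub> h) ` D) (restrict y ((\<lambda>h. g \<otimes>\<^bsub>G\<^esub> h) ` D)) X"
proof -
  interpret group G by fact
  obtain x where x: "x \<in> X" and eq: "restrict x D = (\<lambda>h\<in>D. y (g \<otimes>\<^bsub>G\<^esub> h))"
    using assms(5) by (auto simp: appears_in_def)
  have "shift G g x (g \<otimes>\<^bsub>G\<^esub> h) = y (g \<otimes>\<^bsub>G\<^esub> h)" if "h \<in> D" for h
  proof -
    have "h \<in> carrier G" using that D by auto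
    then have "shift G g x (g \<otimes>\<^bsub>G\<^esub> h) = x h"
      using g by (simp add: shift_def m_assoc[symmetric])
    then show ?thesis using fun_cong[OF eq, of h] that by simp
  qed
  moreover have "shift G g x \<in> X"
    using assms(2) g x by (simp add: subshift_def)
  ultimately show ?thesis
    unfolding appears_in_def by (intro bexI[of _ "shift G g x"]) (auto simp: fun_eq_iff)
qed

lemma not_occurs_if_not_appears:
  assumes "group G" "subshift G A X" "x \<in> X" and g: "g \<in> carrier G"
    and D: "D \<subseteq> carrier G" and p: "p \<in> D \<rightarrow>\<^sub>E A" and "\<not> appears_in D p X"
  shows "\<not> occurs_at G (D, p) g x"
proof
  interpret group G by fact
  assume occ: "occurs_at G (D, p) g x"
  have "restrict (shift G (inv\<^bsub>G\<^esub> g) x) D = p"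
  proof
    fix h
    show "restrict (shift G (inv\<^bsub>G\<^esub> g) x) D h = p h"
    proof (cases "h \<in> D")
      case True
      then have "h \<in> carrier G" using D by auto
      then show ?thesis using True g occ by (simp add: shift_def occurs_at_def)
    next
      case False
      then show ?thesis using p by auto
    qed
  qed
  moreover have "shift G (inv\<^bsub>G\<^esub> g) x \<in> X"
    using assms(2,3) g by (simp add: subshift_def)
  ultimately show False
    using assms(7) by (auto simp: appears_in_def)
qed

text \<open>Mixing is only ever applied to two single sites, with all other sites as the separating set;
  the union of patterns then becomes restriction of one configuration.\<close>

lemma TSSM_glue_two_sites:
  assumes "TSSM_with_gap G K A n X" and y: "y \<in> carrier G \<rightarrow>\<^sub>E A"
    and W: "finite W" "W \<subseteq> carrier G"
    and vw: "v \<in> W" "w \<in> W" "v \<noteq> w" and far: "word_dist G K v w \<ge> n"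
    and "appears_in (W - {w}) (restrict y (W - {w})) X"
    and "appears_in (W - {v}) (restrict y (W - {v})) X"
  shows "appears_in W (restrict y W) X"
proof -
  let ?S = "W - {v, w}"
  have merge_restrict: "merge I J (restrict y I, restrict y J) = restrict y (I \<union> J)" for I J
    by (auto simp: merge_def fun_eq_iff)
  have sets: "{v} \<union> ?S = W - {w}" "?S \<union> {w} = W - {v}" "W - {w} \<union> {w} = W"
    using vw by auto
  have "set_word_dist G K {v} {w} \<ge> enat n"
    using far by (simp add: set_word_dist_def)
  moreover have "restrict y D \<in> D \<rightarrow>\<^sub>E A" if "D \<subseteq> carrier G" for D
    using y that by auto
  ultimately have "appears_in ({v} \<union> ?S \<union> {w})
      (merge ({v} \<union> ?S) {w} (merge {v} ?S (restrict y {v}, restrict y ?S), restrict y {w})) X"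
    using assms(1)[unfolded TSSM_with_gap_def, rule_format,
        of "{v}" "{w}" ?S "restrict y {v}" "restrict y {w}" "restrict y ?S"]
      W vw assms(9,10) by (simp only: merge_restrict sets) auto
  then show ?thesis
    by (simp only: merge_restrict sets)
qed

lemma restrictions_appear:
  assumes "group G" "subshift G A X" and tssm: "TSSM_with_gap G K A n X"
    and y: "y \<in> carrier G \<rightarrow>\<^sub>E A"
    and B: "insert \<one>\<^bsub>G\<^esub> {g \<in> carrier G. word_length G K g < n} \<subseteq> B"
    and local: "\<And>g D. g \<in> carrier G \<Longrightarrow> D \<subseteq> carrier G \<Longrightarrow> D \<subseteq> B \<Longrightarrow>
                  appears_in D (\<lambda>h\<in>D. y (g \<otimes>\<^bsub>G\<^esub> h)) X"
    and "finite W" "W \<subseteq> carrier G"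
  shows "appears_in W (restrict y W) X"
  using assms(7,8)
proof (induction W rule: finite_psubset_induct)
  case (psubset W)
  interpret group G by fact
  show ?case
  proof (cases "W = {}")
    case True
    then show ?thesis using local[of "\<one>\<^bsub>G\<^esub>" "{}"] by (simp add: restrict_def)
  next
    case False
    then obtain w where w: "w \<in> W" by auto
    then have wG: "w \<in> carrier G" using psubset.prems by auto
    show ?thesis
    proof (cases "\<exists>w'\<in>W. w' \<noteq> w \<and> word_dist G K w w' \<ge> n")
      case True
      then obtain w' where w': "w' \<in> W" "w \<noteq> w'" "word_dist G K w w' \<ge> n" by auto
      have "appears_in (W - {a}) (restrict y (W - {a})) X" if "a \<in> W" for a
        using that psubset by blast
      then show ?thesis
        using TSSM_glue_two_sites[OF tssm y psubset.hyps psubset.prems w w'(1,2,3)] w w'(1)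
        by blast
    next
      case False
      let ?D = "(\<lambda>h. inv\<^bsub>G\<^esub> w \<otimes>\<^bsub>G\<^esub> h) ` W"
      have D: "?D \<subseteq> carrier G" using wG psubset.prems by auto
      have "inv\<^bsub>G\<^esub> w \<otimes>\<^bsub>G\<^esub> h \<in> B" if "h \<in> W" for h
      proof (cases "h = w")
        case True
        then show ?thesis using B wG by simp
      next
        case neq: False
        then have "word_length G K (inv\<^bsub>G\<^esub> w \<otimes>\<^bsub>G\<^esub> h) < n"
          using False that by (fastforce simp: word_dist_def)
        then show ?thesis using B D that by auto
      qed
      then have "?D \<subseteq> B" by auto
      from appears_in_translate[OF assms(1,2) wG D local[OF wG D this]]
      have "appears_in ((\<lambda>h. w \<otimes>\<^bsub>G\<^esub> h) ` ?D) (restrict y ((\<lambda>h. w \<otimes>\<^bsub>G\<^esub> h) ` ?D)) X" .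
      moreover have "(\<lambda>h. w \<otimes>\<^bsub>G\<^esub> h) ` ?D = (\<lambda>h. h) ` W"
        unfolding image_image using wG psubset.prems
        by (intro image_cong) (auto simp: m_assoc[symmetric])
      ultimately show ?thesis by (simp only: image_ident)
    qed
  qed
qed

theorem proposition7p9:
  fixes G :: "('g, 'm) monoid_scheme" and K :: "'g set"
    and A :: "'a set" and X :: "('g \<Rightarrow> 'a) set"
  assumes "group G"
    and "finite K" and "K \<subseteq> carrier G" and "generate G K = carrier G"
    and "finite A"
    and "subshift G A X"
    and "TSSM G K A X"
  shows "subshift_of_finite_type G A X"
proof -
  interpret group G by fact
  obtain n where tssm: "TSSM_with_gap G K A n X"
    using assms(7) by (auto simp: TSSM_def)
  \<comment> \<open>The identity is added for the case \<open>n = 0\<close>, where the ball is empty but single sites still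
    have to be constrained.\<close>
  define B where "B = insert \<one>\<^bsub>G\<^esub> {g \<in> carrier G. word_length G K g < n}"
  define F where "F = {(D, p). D \<subseteq> B \<and> p \<in> D \<rightarrow>\<^sub>E A \<and> \<not> appears_in D p X}"
  have finB: "finite B"
    unfolding B_def using finite_word_ball[OF assms(2-4)] by simp
  have BG: "B \<subseteq> carrier G"
    by (auto simp: B_def)
  have "finite (SIGMA D : Pow B. D \<rightarrow>\<^sub>E A)"
    using finB assms(5) by (intro finite_SigmaI finite_PiE) (auto intro: finite_subset)
  then have "finite F"
    by (rule finite_subset[rotated]) (auto simp: F_def)
  moreover have "F \<subseteq> patterns G A"
    using finB BG by (auto simp: F_def patterns_def intro: finite_subset)
  moreover have "X = {x \<in> carrier G \<rightarrow>\<^sub>E A. \<forall>P\<in>F. \<forall>g\<in>carrier G. \<not> occurs_at G P g x}"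
    (is "X = ?Y")
  proof
    show "X \<subseteq> ?Y"
    proof
      fix x assume x: "x \<in> X"
      have "\<not> occurs_at G (D, p) g x" if "(D, p) \<in> F" "g \<in> carrier G" for D p g
        using not_occurs_if_not_appears[OF assms(1,6) x that(2), of D p] that(1) BG
        by (auto simp: F_def)
      then show "x \<in> ?Y"
        using x subshift_subset[OF assms(6)] by auto
    qed
    show "?Y \<subseteq> X"
    proof
      fix y assume yY: "y \<in> ?Y"
      then have y: "y \<in> carrier G \<rightarrow>\<^sub>E A" by simp
      have loc: "appears_in D (\<lambda>h\<in>D. y (g \<otimes>\<^bsub>G\<^esub> h)) X"
        if g: "g \<in> carrier G" and D: "D \<subseteq> carrier G" "D \<subseteq> B" for g D
      proof (rule ccontr)
        let ?p = "\<lambda>h\<in>D. y (g \<otimes>\<^bsub>G\<^esub> h)"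
        assume "\<not> appears_in D ?p X"
        moreover have "?p \<in> D \<rightarrow>\<^sub>E A"
          using y g D(1) by (auto intro!: PiE_mem[OF y])
        ultimately have "(D, ?p) \<in> F"
          using D(2) by (simp add: F_def)
        moreover have "occurs_at G (D, ?p) g y"
          by (simp add: occurs_at_def)
        ultimately show False using yY g by blast
      qed
      show "y \<in> X"
      proof (rule subshift_contains_if_restrictions_appear[OF assms(6) y])
        show "appears_in W (restrict y W) X" if "finite W" "W \<subseteq> carrier G" for W
          using restrictions_appear[where B = B, OF assms(1,6) tssm y eq_refl[OF B_def[symmetric]]]
            loc that by blast
      qed
    qed
  qed
  ultimately show ?thesis
    unfolding subshift_of_finite_type_def using assms(6) by blast
qed

end
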